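(* Let $w$ be an integrable weight function on $[-1,1]$ with $w(x)>0$ almost everywhere, let $n\ge1$, and let $t_1,t_2,\ldots\in(-1,1)$ be distinct. Let $x_i(t_1,\ldots,t_{2n})$ $(i=1,2,\ldots,n)$ be the quadrature nodes for maximum accuracy (Gaussian quadrature). (1) The $n$ nodes $x_i(t_1,\ldots,t_{2n})$ and the $n+1$ nodes $x_i(t_1,\ldots,t_{2n+1},t_{2n+2})$ are strictly interlacing. (2) The $n$ nodes $x_i(t_1,\ldots,t_{2n-1},t_{2n})$ and the $n$ nodes $x_i(t_1,\ldots,t_{2n-1},t_{2n+1})$ are strictly interlacing.
   Context: For distinct $s_1,\ldots,s_{2m}\in(-1,1)$, the Gaussian quadrature nodes $x_1(s_1,\ldots,s_{2m})<\cdots<x_m(s_1,\ldots,s_{2m})$ are the unique $m$ distinct points of $(-1,1)$ for which there are strictly positive weights $\beta_1,\ldots,\beta_m$ with $$\int_{-1}^1\frac{w(x)}{1+s_kx}\,dx=\sum_{i=1}^m\frac{\beta_i}{1+s_kx_i}\qquad(k=1,\ldots,2m).$$ Two finite sets of points whose cardinalities differ by at most one are strictly interlacing if they have no point in common and between any two consecutive points of either set there is exactly one point of the other set. *)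

theory Defs
  imports "HOL-Analysis.Analysis"
begin

definition is_gauss_nodes :: "(real \<Rightarrow> real) \<Rightarrow> nat \<Rightarrow> (nat \<Rightarrow> real) \<Rightarrow> real set \<Rightarrow> bool" where
  "is_gauss_nodes w m s X \<longleftrightarrow>
     finite X \<and> card X = m \<and> X \<subseteq> {-1<..<1} \<and>
     (\<exists>\<beta>. (\<forall>x\<in>X. \<beta> x > 0) \<and>
        (\<forall>k\<in>{1..2 * m}.
           (LINT x:{-1..1}|lebesgue. w x / (1 + s k * x)) = (\<Sum>x\<in>X. \<beta> x / (1 + s k * x))))"

text \<open>Only the values \<open>s 1, \<dots>, s (2 * m)\<close> matter. The description picks out the nodes
  because they exist and are unique whenever \<open>w\<close> is integrable and positive almost
  everywhere on \<open>[-1, 1]\<close> and these values are distinct points of \<open>(-1, 1)\<close>.\<close>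

definition gauss_nodes :: "(real \<Rightarrow> real) \<Rightarrow> nat \<Rightarrow> (nat \<Rightarrow> real) \<Rightarrow> real set" where
  "gauss_nodes w m s = (THE X. is_gauss_nodes w m s X)"

definition consecutive :: "real set \<Rightarrow> real \<Rightarrow> real \<Rightarrow> bool" where
  "consecutive A a b \<longleftrightarrow> a \<in> A \<and> b \<in> A \<and> a < b \<and> A \<inter> {a<..<b} = {}"

definition strictly_interlacing :: "real set \<Rightarrow> real set \<Rightarrow> bool" where
  "strictly_interlacing A B \<longleftrightarrow>
     finite A \<and> finite B \<and> card A \<le> card B + 1 \<and> card B \<le> card A + 1 \<and>
     A \<inter> B = {} \<and>
     (\<forall>a b. consecutive A a b \<longrightarrow> (\<exists>!c. c \<in> B \<and> a < c \<and> c < b)) \<and>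
     (\<forall>a b. consecutive B a b \<longrightarrow> (\<exists>!c. c \<in> A \<and> a < c \<and> c < b))"

end

theory Submission imports Defs "HOL-Computational_Algebra.Polynomial" begin

text \<open>The idea is to subtract two quadrature rules from each other. By partial fractions, the functions
  \<open>1 / (1 + s * x)\<close> with \<open>s\<close> in a set \<open>S\<close> of \<open>N\<close> parameters span all \<open>p / pole_poly S\<close> with \<open>p\<close> a polynomial
  of degree below \<open>N\<close> (\<open>pole_poly_span\<close>). So they form a Chebyshev system. A combination of point
  evaluations that annihilates it is trivial if it has at most \<open>N\<close> points
  (\<open>few_points_coefficient_0\<close>), and with \<open>N + 1\<close> points its coefficients cannot have the same strict
  sign at two neighbouring points (\<open>neighbours_opposite_signs\<close>). If two rules with positive weights
  and node sets \<open>A\<close>, \<open>B\<close> are exact for the same \<open>N\<close> functions and \<open>card A + card B \<le> N + 1\<close>, then their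
  difference is such a combination: either the rules coincide, or \<open>A\<close> and \<open>B\<close> are disjoint and
  alternate (\<open>two_rules_cases\<close>).

  For the first claim the common parameters are \<open>t 1, \<dots>, t (2 * n)\<close>, with \<open>n + (n + 1)\<close> nodes, and the
  rules differ because their numbers of nodes differ. For the second they are
  \<open>t 1, \<dots>, t (2 * n - 1)\<close>, with \<open>n + n\<close> nodes; equal rules would be exact for \<open>2 * n + 1\<close> functions,
  which is impossible because the squared node polynomial has a positive integral
  (\<open>positive_rule_not_overexact\<close>).

  The same dichotomy, applied to two rules with \<open>m\<close> nodes and \<open>2 * m\<close> common parameters, gives the
  uniqueness of Gaussian nodes. For their existence, clearing denominators turns the defining
  equations into classical Gaussian quadrature for the weight \<open>w / pole_poly S\<close>, whose nodes are the
  roots of an orthogonal polynomial (\<open>gauss_quadrature\<close>, \<open>positive_rule_exists\<close>). Existence and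
  uniqueness together give \<open>gauss_nodes\<close> its meaning (\<open>gauss_nodes_rule\<close>).\<close>

section \<open>Partial fractions\<close>

definition root_poly :: "real set \<Rightarrow> real poly" where
  "root_poly X = (\<Prod>a\<in>X. [:- a, 1:])"

text \<open>The common denominator of the functions \<open>1 / (1 + s * x)\<close> for \<open>s \<in> S\<close>. Its degree is below
  \<open>card S\<close> when \<open>0 \<in> S\<close>, because the pole \<open>-1/s\<close> then lies at infinity.\<close>
definition pole_poly :: "real set \<Rightarrow> real poly" where
  "pole_poly S = (\<Prod>s\<in>S. [:1, s:])"

lemma poly_root_poly: "poly (root_poly X) x = (\<Prod>a\<in>X. x - a)"
  by (simp add: root_poly_def poly_prod)

lemma poly_root_poly_eq_0_iff: "finite X \<Longrightarrow> poly (root_poly X) x = 0 \<longleftrightarrow> x \<in> X"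
  by (auto simp: poly_root_poly)

lemma root_poly_nonzero: "root_poly X \<noteq> 0"
  by (cases "finite X") (auto simp: root_poly_def)

lemma degree_root_poly: "degree (root_poly X) = card X"
  unfolding root_poly_def by (subst degree_prod_sum_eq) auto

lemma poly_pole_poly: "poly (pole_poly S) x = (\<Prod>s\<in>S. 1 + s * x)"
  by (simp add: pole_poly_def poly_prod mult.commute)

lemma pole_poly_insert: "finite S \<Longrightarrow> l \<notin> S \<Longrightarrow> pole_poly (insert l S) = [:1, l:] * pole_poly S"
  by (simp add: pole_poly_def)

lemma degree_pole_poly_le: "degree (pole_poly S) \<le> card S"
proof (cases "finite S")
  case True
  have "degree (pole_poly S) \<le> (\<Sum>s\<in>S. degree [:1, s:])"
    using degree_prod_sum_le[OF True, of "\<lambda>s. [:1, s:]"] by (simp add: pole_poly_def o_def)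
  also have "\<dots> \<le> (\<Sum>s\<in>S. 1)" by (intro sum_mono) auto
  finally show ?thesis by simp
qed (simp add: pole_poly_def)

lemma one_plus_mult_pos:
  fixes s x :: real
  assumes "s \<in> {-1<..<1}" "x \<in> {-1..1}"
  shows "1 + s * x > 0"
proof -
  have "\<bar>s * x\<bar> = \<bar>s\<bar> * \<bar>x\<bar>" by (simp add: abs_mult)
  also have "\<dots> \<le> \<bar>s\<bar> * 1" using assms by (intro mult_left_mono) auto
  also have "\<dots> < 1" using assms by auto
  finally show ?thesis by linarith
qed

lemma pole_poly_pos:
  assumes "S \<subseteq> {-1<..<1}" "x \<in> {-1..1}"
  shows "poly (pole_poly S) x > 0"
  unfolding poly_pole_poly by (intro prod_pos) (use assms one_plus_mult_pos in auto)

lemma coeff_pole_poly_card: "coeff (pole_poly S) (card S) = \<Prod>S"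
proof (induction S rule: infinite_finite_induct)
  case (insert l S)
  have "coeff (pole_poly S) (Suc (card S)) = 0"
    using degree_pole_poly_le[of S] by (intro coeff_eq_0) simp
  then show ?case using insert by (simp add: pole_poly_insert)
qed (auto simp: pole_poly_def)

text \<open>Adding a pole \<open>-1/l\<close> to \<open>S\<close>: the constant \<open>a\<close> is chosen to make the difference
  \<open>p - smult a (pole_poly S)\<close> vanish at that pole, so that \<open>[:1, l:]\<close> divides it. For \<open>l = 0\<close> the pole
  is at infinity, and vanishing there means cancelling the coefficient of degree \<open>card S\<close>.\<close>
lemma pole_poly_eliminate:
  assumes "finite S" "l \<notin> S" "degree p \<le> card S"
  obtains a r where "p = smult a (pole_poly S) + [:1, l:] * r" "r = 0 \<or> degree r < card S"
proof (cases "l = 0")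
  case True
  define a where "a = coeff p (card S) / \<Prod>S"
  define r where "r = p - smult a (pole_poly S)"
  have "\<Prod>S \<noteq> 0" using assms True by auto
  then have 0: "coeff r (card S) = 0"
    by (simp add: r_def a_def coeff_pole_poly_card)
  have "degree r \<le> card S"
    unfolding r_def using assms degree_pole_poly_le[of S]
    by (intro degree_diff_le) (auto intro: order.trans[OF degree_smult_le])
  then have "r = 0 \<or> degree r < card S"
    using 0 by (metis leading_coeff_0_iff order_le_less)
  then show ?thesis using that[of a r] True by (simp add: r_def)
next
  case False
  have nz: "poly (pole_poly S) (- 1 / l) \<noteq> 0"
    using assms False by (auto simp: poly_pole_poly field_simps)
  define a where "a = poly p (- 1 / l) / poly (pole_poly S) (- 1 / l)"
  define q where "q = p - smult a (pole_poly S)"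
  have "poly q (- 1 / l) = 0" using nz by (simp add: q_def a_def)
  then obtain k where k: "q = [:1 / l, 1:] * k"
    by (auto simp: poly_eq_0_iff_dvd dvd_def)
  have "degree q \<le> card S"
    unfolding q_def using assms degree_pole_poly_le[of S]
    by (intro degree_diff_le) (auto intro: order.trans[OF degree_smult_le])
  then have "k = 0 \<or> degree k < card S"
    by (cases "k = 0") (auto simp: k degree_mult_eq simp del: mult_pCons_left)
  moreover have "q = [:1, l:] * smult (1 / l) k"
    using False by (simp add: k smult_add_right)
  ultimately show ?thesis
    using that[of a "smult (1 / l) k"] by (simp add: q_def algebra_simps del: mult_pCons_left)
qed

text \<open>The span of \<open>1 / (1 + s * x)\<close>, \<open>s \<in> S\<close>, is the whole space of polynomials of degree below
  \<open>card S\<close> divided by \<open>pole_poly S\<close>. This is what turns the given test functions into polynomials.\<close>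
lemma pole_poly_span:
  assumes "finite S" "p = 0 \<or> degree p < card S"
  shows "\<exists>c. p = (\<Sum>s\<in>S. smult (c s) (pole_poly (S - {s})))"
  using assms
proof (induction S arbitrary: p rule: finite_induct)
  case empty
  then show ?case by auto
next
  case (insert l S)
  have "degree p \<le> card S" using insert by auto
  then obtain a r where p: "p = smult a (pole_poly S) + [:1, l:] * r"
    and r: "r = 0 \<or> degree r < card S"
    using pole_poly_eliminate insert by metis
  obtain c where c: "r = (\<Sum>s\<in>S. smult (c s) (pole_poly (S - {s})))"
    using insert.IH[OF r] by blast
  have "pole_poly (insert l S - {s}) = [:1, l:] * pole_poly (S - {s})" if "s \<in> S" for s
  proof -
    have "insert l S - {s} = insert l (S - {s})" using that insert by auto
    then show ?thesis using insert by (simp add: pole_poly_insert del: mult_pCons_left)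
  qed
  then have "(\<Sum>s\<in>S. smult (c s) (pole_poly (insert l S - {s}))) = [:1, l:] * r"
    unfolding c sum_distrib_left by (intro sum.cong) (auto simp del: mult_pCons_left)
  moreover have "(\<Sum>s\<in>S. smult ((c(l := a)) s) (pole_poly (insert l S - {s})))
      = (\<Sum>s\<in>S. smult (c s) (pole_poly (insert l S - {s})))"
    using insert by (intro sum.cong) auto
  ultimately have "p = (\<Sum>s\<in>insert l S. smult ((c(l := a)) s) (pole_poly (insert l S - {s})))"
    using insert by (simp add: p del: mult_pCons_left)
  then show ?case by blast
qed

lemma partial_fractions:
  assumes "finite S" "degree p < card S"
  obtains c where "\<And>x. (\<forall>s\<in>S. 1 + s * x \<noteq> 0) \<Longrightarrow>
    poly p x / poly (pole_poly S) x = (\<Sum>s\<in>S. c s / (1 + s * x))"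
proof -
  obtain c where c: "p = (\<Sum>s\<in>S. smult (c s) (pole_poly (S - {s})))"
    using pole_poly_span assms by blast
  have "poly p x / poly (pole_poly S) x = (\<Sum>s\<in>S. c s / (1 + s * x))"
    if nz: "\<forall>s\<in>S. 1 + s * x \<noteq> 0" for x
  proof -
    have "c s * poly (pole_poly (S - {s})) x / poly (pole_poly S) x = c s / (1 + s * x)"
      if "s \<in> S" for s
    proof -
      have "poly (pole_poly S) x = (1 + s * x) * poly (pole_poly (S - {s})) x"
        using assms(1) that by (simp add: poly_pole_poly prod.remove)
      moreover have "poly (pole_poly (S - {s})) x \<noteq> 0"
        using nz assms(1) by (auto simp: poly_pole_poly)
      ultimately show ?thesis using nz by simp
    qed
    then show ?thesis
      by (simp add: c poly_sum sum_divide_distrib)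
  qed
  then show ?thesis using that by blast
qed

section \<open>Discrete functionals that annihilate a Chebyshev system\<close>

lemma sum_partial_fractions_eq_0:
  assumes "finite S" "S \<subseteq> {-1<..<1}" "Z \<subseteq> {-1<..<1}" "degree p < card S"
    and zero: "\<And>s. s \<in> S \<Longrightarrow> (\<Sum>z\<in>Z. c z / (1 + s * z)) = 0"
  shows "(\<Sum>z\<in>Z. c z / poly (pole_poly S) z * poly p z) = 0"
proof -
  obtain d where d: "\<And>x. (\<forall>s\<in>S. 1 + s * x \<noteq> 0) \<Longrightarrow>
    poly p x / poly (pole_poly S) x = (\<Sum>s\<in>S. d s / (1 + s * x))"
    using partial_fractions assms by blast
  have "c z / poly (pole_poly S) z * poly p z = (\<Sum>s\<in>S. d s * (c z / (1 + s * z)))"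
    if "z \<in> Z" for z
  proof -
    have "\<forall>s\<in>S. 1 + s * z \<noteq> 0"
      using one_plus_mult_pos assms(2,3) that by (metis greaterThanLessThan_subseteq_atLeastAtMost_iff
          less_irrefl order_refl subsetD)
    from d[OF this] have "c z * (poly p z / poly (pole_poly S) z) = c z * (\<Sum>s\<in>S. d s / (1 + s * z))"
      by simp
    then show ?thesis by (simp add: sum_distrib_left mult_ac)
  qed
  then have "(\<Sum>z\<in>Z. c z / poly (pole_poly S) z * poly p z)
      = (\<Sum>z\<in>Z. \<Sum>s\<in>S. d s * (c z / (1 + s * z)))"
    by (rule sum.cong[OF refl])
  also have "\<dots> = (\<Sum>s\<in>S. d s * (\<Sum>z\<in>Z. c z / (1 + s * z)))"
    by (subst sum.swap) (simp only: sum_distrib_left)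
  also have "\<dots> = 0" using zero by simp
  finally show ?thesis .
qed

text \<open>The functions \<open>1 / (1 + s * x)\<close> form a Chebyshev system on \<open>(-1, 1)\<close>: a polynomial that vanishes
  at all points but \<open>x\<close> has low enough degree to be a test function, and it isolates \<open>c x\<close>.\<close>
lemma few_points_coefficient_0:
  fixes Z :: "real set"
  assumes "finite S" "S \<subseteq> {-1<..<1}" "finite Z" "Z \<subseteq> {-1<..<1}" "card Z \<le> card S"
    and zero: "\<And>s. s \<in> S \<Longrightarrow> (\<Sum>z\<in>Z. c z / (1 + s * z)) = 0"
    and x: "x \<in> Z"
  shows "c x = 0"
proof -
  let ?p = "root_poly (Z - {x})"
  have "card (Z - {x}) < card Z" using assms(3) x by (intro psubset_card_mono) auto
  then have "degree ?p < card S" using assms(5) by (simp add: degree_root_poly)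
  then have "0 = (\<Sum>z\<in>Z. c z / poly (pole_poly S) z * poly ?p z)"
    by (rule sum_partial_fractions_eq_0[OF assms(1,2,4) _ zero, symmetric])
  also have "\<dots> = (\<Sum>z\<in>{x}. c z / poly (pole_poly S) z * poly ?p z)"
    using assms(3) x by (intro sum.mono_neutral_right) (auto simp: poly_root_poly)
  finally have "c x / poly (pole_poly S) x * poly ?p x = 0" by simp
  moreover have "poly ?p x \<noteq> 0" using assms(3) by (simp add: poly_root_poly_eq_0_iff)
  moreover have "poly (pole_poly S) x > 0" using assms x by (intro pole_poly_pos) force+
  ultimately show ?thesis by simp
qed

text \<open>With one point more than test functions, the test polynomial may vanish at all points but two.
  If these are neighbours, it has the same sign at both, so their coefficients cannot agree in sign.\<close>
lemma neighbours_opposite_signs: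
  assumes "finite S" "S \<subseteq> {-1<..<1}" "S \<noteq> {}" "finite Z" "Z \<subseteq> {-1<..<1}" "card Z = card S + 1"
    and zero: "\<And>s. s \<in> S \<Longrightarrow> (\<Sum>z\<in>Z. c z / (1 + s * z)) = 0"
    and xy: "consecutive Z x y"
  shows "\<not> (c x > 0 \<and> c y > 0)" "\<not> (c x < 0 \<and> c y < 0)"
proof -
  let ?p = "root_poly (Z - {x, y})"
  let ?d = "\<lambda>z. poly ?p z / poly (pole_poly S) z"
  have x: "x \<in> Z" and y: "y \<in> Z" and less: "x < y" and between: "Z \<inter> {x<..<y} = {}"
    using xy by (auto simp: consecutive_def)
  have "card (Z - {x, y}) = card Z - 2"
    using x y less assms(4) by (subst card_Diff_subset) auto
  moreover have "card S > 0" using assms(1,3) by (simp add: card_gt_0_iff)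
  ultimately have "degree ?p < card S" using assms(6) by (simp add: degree_root_poly)
  then have "0 = (\<Sum>z\<in>Z. c z / poly (pole_poly S) z * poly ?p z)"
    by (rule sum_partial_fractions_eq_0[OF assms(1,2,5) _ zero, symmetric])
  also have "\<dots> = (\<Sum>z\<in>{x, y}. c z / poly (pole_poly S) z * poly ?p z)"
    using assms(4) x y by (intro sum.mono_neutral_right) (auto simp: poly_root_poly)
  finally have sum: "c x * ?d x + c y * ?d y = 0" using less by simp
  have "poly ?p x * poly ?p y = (\<Prod>a\<in>Z - {x, y}. (x - a) * (y - a))"
    by (simp add: poly_root_poly prod.distrib)
  also have "\<dots> > 0"
  proof (rule prod_pos)
    fix a assume a: "a \<in> Z - {x, y}"
    then have "a < x \<or> y < a" using between by force
    then show "(x - a) * (y - a) > 0" using less by (auto intro: mult_neg_neg)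
  qed
  finally have "poly ?p x * poly ?p y > 0" .
  moreover have "poly (pole_poly S) x > 0" "poly (pole_poly S) y > 0"
    using assms(2,5) x y by (intro pole_poly_pos; force)+
  ultimately have d: "(?d x > 0 \<and> ?d y > 0) \<or> (?d x < 0 \<and> ?d y < 0)"
    by (auto simp: zero_less_mult_iff divide_less_0_iff)
  show "\<not> (c x > 0 \<and> c y > 0)" "\<not> (c x < 0 \<and> c y < 0)"
    using sum d by (smt (verit) mult_pos_pos mult_neg_neg mult_pos_neg mult_neg_pos)+
qed

lemma alternating_imp_between:
  assumes fin: "finite A" "finite B"
    and alt: "\<And>a b. consecutive (A \<union> B) a b \<Longrightarrow> \<not> (a \<in> A \<and> b \<in> A) \<and> \<not> (a \<in> B \<and> b \<in> B)"
    and ab: "consecutive A a b"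
  shows "\<exists>!c. c \<in> B \<and> a < c \<and> c < b"
proof -
  have a: "a \<in> A" "b \<in> A" "a < b" "A \<inter> {a<..<b} = {}"
    using ab by (auto simp: consecutive_def)
  have ex: "\<exists>c. c \<in> B \<and> a < c \<and> c < b"
  proof (rule ccontr)
    assume "\<not> ?thesis"
    then have "consecutive (A \<union> B) a b" using a by (auto simp: consecutive_def)
    then show False using alt a by blast
  qed
  have no_pair: False if c: "c \<in> B" "a < c" and c': "c' \<in> B" "c' < b" and less: "c < c'" for c c'
  proof -
    \<comment> \<open>The successor \<open>m\<close> of \<open>c\<close> in \<open>B\<close> is also its successor in \<open>A \<union> B\<close>, as \<open>A\<close> does not meet \<open>(a, b)\<close>.\<close>
    define m where "m = Min (B \<inter> {c<..})"
    have ne: "finite (B \<inter> {c<..})" "B \<inter> {c<..} \<noteq> {}" using fin less c' by auto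
    have m: "m \<in> B" "c < m" using Min_in[OF ne] by (auto simp: m_def)
    have "m \<le> c'" unfolding m_def using ne less c' by (intro Min_le) auto
    moreover have "z \<notin> B" if "c < z" "z < m" for z
      using Min_le[OF ne(1), of z] that by (auto simp: m_def)
    ultimately have "consecutive (A \<union> B) c m"
      using c c' m a(4) by (auto simp: consecutive_def)
    then show False using alt c m by blast
  qed
  show ?thesis using ex no_pair by (metis linorder_neqE_linordered_idom)
qed

text \<open>The difference of the two sums is one discrete functional on \<open>A \<union> B\<close> that annihilates the
  Chebyshev system. Either \<open>A \<union> B\<close> is small and the functional is zero, or the sets are disjoint and its
  coefficients, positive on \<open>A\<close> and negative on \<open>B\<close>, alternate in sign.\<close>
lemma two_rules_cases:
  assumes S: "finite S" "S \<subseteq> {-1<..<1}" "S \<noteq> {}"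
    and A: "finite A" "A \<subseteq> {-1<..<1}" "\<And>x. x \<in> A \<Longrightarrow> \<alpha> x > 0"
    and B: "finite B" "B \<subseteq> {-1<..<1}" "\<And>x. x \<in> B \<Longrightarrow> \<beta> x > 0"
    and card: "card A + card B \<le> card S + 1" "card A \<le> card B + 1" "card B \<le> card A + 1"
    and eq: "\<And>s. s \<in> S \<Longrightarrow> (\<Sum>x\<in>A. \<alpha> x / (1 + s * x)) = (\<Sum>x\<in>B. \<beta> x / (1 + s * x))"
  shows "(A = B \<and> (\<forall>x\<in>A. \<alpha> x = \<beta> x)) \<or>
    (card A + card B = card S + 1 \<and> strictly_interlacing A B)"
proof -
  define Z where "Z = A \<union> B"
  define c where "c x = (if x \<in> A then \<alpha> x else 0) - (if x \<in> B then \<beta> x else 0)" for x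
  have Z: "finite Z" "Z \<subseteq> {-1<..<1}" using A B by (auto simp: Z_def)
  have zero: "(\<Sum>z\<in>Z. c z / (1 + s * z)) = 0" if "s \<in> S" for s
  proof -
    have "(\<Sum>z\<in>Z. c z / (1 + s * z))
      = (\<Sum>z\<in>Z. if z \<in> A then \<alpha> z / (1 + s * z) else 0) - (\<Sum>z\<in>Z. if z \<in> B then \<beta> z / (1 + s * z) else 0)"
      unfolding sum_subtractf[symmetric] by (intro sum.cong) (auto simp: c_def diff_divide_distrib)
    also have "\<dots> = (\<Sum>z\<in>Z \<inter> A. \<alpha> z / (1 + s * z)) - (\<Sum>z\<in>Z \<inter> B. \<beta> z / (1 + s * z))"
      using Z(1) by (simp add: sum.inter_restrict)
    finally show ?thesis using eq that by (simp add: Z_def Int_absorb1 Int_absorb2)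
  qed
  have card_Z: "card Z + card (A \<inter> B) = card A + card B"
    using card_Un_Int[OF A(1) B(1)] by (simp add: Z_def)
  show ?thesis
  proof (cases "card Z \<le> card S")
    case True
    have c0: "c x = 0" if "x \<in> Z" for x
      using few_points_coefficient_0[OF S(1,2) Z True] zero that by blast
    have "x \<in> B \<and> \<alpha> x = \<beta> x" if "x \<in> A" for x
      using c0[of x] A(3)[OF that] that by (auto simp: c_def Z_def split: if_splits)
    moreover have "x \<in> A" if "x \<in> B" for x
      using c0[of x] B(3)[OF that] that by (auto simp: c_def Z_def split: if_splits)
    ultimately have "A = B" "\<forall>x\<in>A. \<alpha> x = \<beta> x" by auto
    then show ?thesis by blast
  next
    case False
    then have "card (A \<inter> B) = 0" and cZ: "card Z = card S + 1" using card card_Z by auto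
    then have disj: "A \<inter> B = {}" using A(1) by simp
    have "c x > 0" if "x \<in> A" for x using A(3)[OF that] disj that by (auto simp: c_def)
    moreover have "c x < 0" if "x \<in> B" for x using B(3)[OF that] disj that by (auto simp: c_def)
    ultimately have alt: "\<not> (a \<in> A \<and> b \<in> A) \<and> \<not> (a \<in> B \<and> b \<in> B)" if "consecutive Z a b" for a b
      using neighbours_opposite_signs[OF S Z cZ zero that] by blast
    have "\<exists>!c. c \<in> B \<and> a < c \<and> c < b" if "consecutive A a b" for a b
      using alternating_imp_between[OF A(1) B(1) _ that] alt by (simp add: Z_def)
    moreover have "\<exists>!c. c \<in> A \<and> a < c \<and> c < b" if "consecutive B a b" for a b
      using alternating_imp_between[OF B(1) A(1) _ that] alt by (auto simp: Z_def Un_commute)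
    ultimately have "strictly_interlacing A B"
      using A(1) B(1) card disj by (simp add: strictly_interlacing_def)
    moreover have "card A + card B = card S + 1" using cZ card_Z disj by simp
    ultimately show ?thesis by blast
  qed
qed

section \<open>Gaussian quadrature for polynomials\<close>

text \<open>An abstraction of integration against a weight on \<open>(-1, 1)\<close>, covering all the weights
  \<open>w / pole_poly S\<close> at once.\<close>
locale positive_functional =
  fixes L :: "real poly \<Rightarrow> real"
  assumes add: "L (p + q) = L p + L q"
    and smult: "L (smult c p) = c * L p"
    and pos: "p \<noteq> 0 \<Longrightarrow> (\<And>x. x \<in> {-1<..<1} \<Longrightarrow> poly p x \<ge> 0) \<Longrightarrow> L p > 0"
begin

lemma zero: "L 0 = 0"
  using smult[of 0 0] by simp

lemma diff: "L (p - q) = L p - L q"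
  using add[of p "smult (-1) q"] smult[of "-1" q] by simp

lemma sum: "L (\<Sum>i\<in>I. f i) = (\<Sum>i\<in>I. L (f i))"
  by (induction I rule: infinite_finite_induct) (auto simp: zero add)

lemma square_pos: "p \<noteq> 0 \<Longrightarrow> L (p * p) > 0"
  by (rule pos) auto

text \<open>Gram-Schmidt applied to the monomials.\<close>
lemma orthogonal_poly_exists:
  "\<exists>q. degree q = n \<and> lead_coeff q = 1 \<and> (\<forall>p. degree p < n \<longrightarrow> L (q * p) = 0)"
proof (induction n rule: less_induct)
  case (less n)
  then obtain e where e: "\<And>k. k < n \<Longrightarrow> degree (e k) = k"
      "\<And>k. k < n \<Longrightarrow> lead_coeff (e k) = 1"
      "\<And>k p. k < n \<Longrightarrow> degree p < k \<Longrightarrow> L (e k * p) = 0"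
    by metis
  define g where "g = (\<Sum>k<n. smult (L (monom 1 n * e k) / L (e k * e k)) (e k))"
  define q where "q = monom 1 n - g"
  have orth: "L (e j * e k) = 0" if "j < n" "k < n" "j \<noteq> k" for j k
    using that e(1,3)[of j] e(1,3)[of k] by (metis linorder_neqE_nat mult.commute)
  have qe: "L (q * e j) = 0" if j: "j < n" for j
  proof -
    have "e j \<noteq> 0" using e(2)[OF j] by auto
    then have "L (e j * e j) > 0" by (rule square_pos)
    have "L (g * e j) = (\<Sum>k<n. L (monom 1 n * e k) / L (e k * e k) * L (e k * e j))"
      by (simp add: g_def sum_distrib_right sum smult)
    also have "\<dots> = (\<Sum>k\<in>{j}. L (monom 1 n * e k) / L (e k * e k) * L (e k * e j))"
      using j orth by (intro sum.mono_neutral_right) auto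
    also have "\<dots> = L (monom 1 n * e j)" using \<open>L (e j * e j) > 0\<close> by simp
    finally show ?thesis by (simp add: q_def diff left_diff_distrib)
  qed
  have low: "L (q * p) = 0" if "m \<le> n" "\<forall>i\<ge>m. coeff p i = 0" for m p
    using that
  proof (induction m arbitrary: p)
    case 0
    then have "p = 0" by (simp add: poly_eq_iff)
    then show ?case by (simp add: zero)
  next
    case (Suc m)
    define r where "r = p - smult (coeff p m) (e m)"
    have "coeff (e m) m = 1" using e(1,2)[of m] Suc by simp
    moreover have "coeff (e m) i = 0" if "i > m" for i
      using e(1)[of m] Suc that by (intro coeff_eq_0) simp
    ultimately have "coeff r i = 0" if "i \<ge> m" for i
      using Suc.prems(2) that by (cases "i = m") (simp_all add: r_def)
    then have "L (q * r) = 0" using Suc by simp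
    moreover have "q * p = q * r + smult (coeff p m) (q * e m)"
      by (simp add: r_def algebra_simps)
    ultimately show ?case using qe[of m] Suc.prems by (simp add: add smult)
  qed
  have g: "coeff g i = 0" if "i \<ge> n" for i
    unfolding g_def coeff_sum using e(1) that by (intro sum.neutral) (auto intro!: coeff_eq_0)
  have "coeff q n = 1" using g by (simp add: q_def)
  moreover have "coeff q i = 0" if "i > n" for i using g that by (simp add: q_def)
  ultimately have "degree q = n"
    by (intro antisym degree_le le_degree) auto
  moreover have "L (q * p) = 0" if "degree p < n" for p
    using low[of n p] that by (simp add: coeff_eq_0)
  ultimately show ?case using \<open>coeff q n = 1\<close> by (intro exI[of _ q]) auto
qed

text \<open>Let \<open>q\<close> be the product of \<open>root_poly X\<close> and \<open>h\<close>. A root of \<open>h\<close> in the interval would be a double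
  root of \<open>q\<close>, and removing it twice from \<open>q\<close> leaves \<open>u\<close> of lower degree with \<open>q * u\<close> a square,
  against orthogonality. So \<open>h\<close> has constant sign, and so has \<open>q * root_poly X\<close>; orthogonality then
  excludes \<open>card X < n\<close>.\<close>
lemma orthogonal_poly_roots:
  assumes deg: "degree q = n" and q: "q \<noteq> 0" and orth: "\<And>p. degree p < n \<Longrightarrow> L (q * p) = 0"
  defines "X \<equiv> {x. poly q x = 0 \<and> x \<in> {-1<..<1}}"
  shows "finite X" "card X = n"
proof -
  show fin: "finite X"
    unfolding X_def using poly_roots_finite[OF q] by (rule finite_subset[rotated]) auto
  have "card X \<le> card {x. poly q x = 0}"
    unfolding X_def using poly_roots_finite[OF q] by (intro card_mono) auto
  then have le: "card X \<le> n" using card_poly_roots_bound[OF q] deg by simp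
  have "root_poly Y dvd q" if "finite Y" "Y \<subseteq> X" for Y
    using that
  proof (induction Y rule: finite_induct)
    case (insert a Y)
    then obtain h where h: "q = root_poly Y * h" by (auto simp: dvd_def)
    have "poly q a = 0" using insert by (auto simp: X_def)
    then have "poly h a = 0" using insert poly_root_poly_eq_0_iff[of Y a] by (simp add: h)
    then obtain k where "h = [:-a, 1:] * k" by (auto simp: poly_eq_0_iff_dvd dvd_def)
    then have "q = root_poly (insert a Y) * k"
      using insert by (simp add: h root_poly_def mult_ac del: mult_pCons_left mult_pCons_right)
    then show ?case by simp
  qed (simp add: root_poly_def)
  from this[OF fin order_refl] obtain h where h: "q = root_poly X * h" by (auto simp: dvd_def)
  have nr: "poly h x \<noteq> 0" if x: "x \<in> {-1<..<1}" for x
  proof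
    assume hx: "poly h x = 0"
    then have "poly q x = 0" by (subst h) simp
    then have "x \<in> X" using x by (simp add: X_def)
    obtain k where k: "h = [:-x, 1:] * k" using hx by (auto simp: poly_eq_0_iff_dvd dvd_def)
    define u where "u = root_poly (X - {x}) * k"
    have q': "q = [:-x, 1:] * [:-x, 1:] * u"
      using \<open>x \<in> X\<close> fin
      by (simp add: h k u_def root_poly_def prod.remove[of X x] mult_ac
          del: mult_pCons_left mult_pCons_right)
    have "u \<noteq> 0" using q q' by auto
    moreover have "[:-x, 1:] * [:-x, 1:] \<noteq> 0" "degree ([:-x, 1:] * [:-x, 1:]) = 2" by simp_all
    ultimately have "degree q = 2 + degree u"
      unfolding q' by (simp only: degree_mult_eq not_False_eq_True)
    then have "L (q * u) = 0" using deg by (intro orth) simp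
    moreover have "q * u = ([:-x, 1:] * u) * ([:-x, 1:] * u)"
      by (simp add: q' mult_ac del: mult_pCons_left mult_pCons_right)
    moreover have "[:-x, 1:] * u \<noteq> 0" using \<open>u \<noteq> 0\<close> by (simp del: mult_pCons_left)
    ultimately show False using square_pos[of "[:-x, 1:] * u"] by simp
  qed
  have sign: "(\<forall>x\<in>{-1<..<1}. poly h x > 0) \<or> (\<forall>x\<in>{-1<..<1}. poly h x < 0)"
  proof (rule ccontr)
    assume "\<not> ?thesis"
    then obtain x y where xy: "x \<in> {-1<..<1}" "y \<in> {-1<..<1}" "poly h x < 0" "poly h y > 0"
      using nr by (meson linorder_neqE_linordered_idom)
    then have "x \<noteq> y" by auto
    then obtain z where "z \<in> {-1<..<1}" "poly h z = 0"
    proof (cases "x < y")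
      case True
      with xy obtain z where "x < z" "z < y" "poly h z = 0"
        using poly_IVT_pos by blast
      then show ?thesis using xy by (intro that[of z]) auto
    next
      case False
      with \<open>x \<noteq> y\<close> xy obtain z where "y < z" "z < x" "poly h z = 0"
        using poly_IVT_neg[of y x h] by auto
      then show ?thesis using xy by (intro that[of z]) auto
    qed
    then show False using nr by blast
  qed
  show "card X = n"
  proof (rule ccontr)
    assume "card X \<noteq> n"
    then have 0: "L (q * root_poly X) = 0" using le by (intro orth) (simp add: degree_root_poly)
    define p where "p = q * root_poly X"
    have p: "poly p x = (poly (root_poly X) x)\<^sup>2 * poly h x" for x
      by (simp add: p_def h power2_eq_square)
    have p0: "p \<noteq> 0" using q by (simp add: p_def root_poly_nonzero)
    show False
      using sign
    proof
      assume "\<forall>x\<in>{-1<..<1}. poly h x > 0"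
      then have "L p > 0" using p0 by (intro pos) (auto simp: p less_imp_le)
      then show False using 0 by (simp add: p_def)
    next
      assume "\<forall>x\<in>{-1<..<1}. poly h x < 0"
      then have "L (smult (-1) p) > 0"
        using p0 by (intro pos) (auto simp: p mult_nonneg_nonpos less_imp_le)
      then show False using 0 by (simp add: p_def smult del: smult_minus_left)
    qed
  qed
qed

text \<open>The classical argument: interpolation at the roots of the orthogonal polynomial \<open>q\<close> is exact below
  degree \<open>n\<close>, division by \<open>q\<close> raises this to \<open>2 * n\<close>, and testing with the squares of the Lagrange
  polynomials shows that the weights are positive.\<close>
theorem gauss_quadrature:
  obtains X \<omega> where "finite X" "card X = n" "X \<subseteq> {-1<..<1}" "\<And>x. x \<in> X \<Longrightarrow> \<omega> x > 0"
    "\<And>p. degree p < 2 * n \<Longrightarrow> L p = (\<Sum>x\<in>X. \<omega> x * poly p x)"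
proof -
  obtain q where q: "degree q = n" "lead_coeff q = 1" "\<And>p. degree p < n \<Longrightarrow> L (q * p) = 0"
    using orthogonal_poly_exists by metis
  have q0: "q \<noteq> 0" using q(2) by auto
  define X where "X = {x. poly q x = 0 \<and> x \<in> {-1<..<1}}"
  have X: "finite X" "card X = n"
    unfolding X_def using orthogonal_poly_roots[OF q(1) q0 q(3)] by auto
  define l where "l a = smult (1 / poly (root_poly (X - {a})) a) (root_poly (X - {a}))" for a
  have deg_l: "degree (l a) < n" if "a \<in> X" for a
  proof -
    have "card (X - {a}) < card X" using X(1) that by (intro psubset_card_mono) auto
    then show ?thesis using X(2) degree_smult_le[of _ "root_poly (X - {a})"]
      by (metis l_def degree_root_poly order_le_less_trans)
  qed
  have l: "poly (l a) b = (if a = b then 1 else 0)" if "b \<in> X" for a b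
    using that X(1) by (auto simp: l_def poly_root_poly_eq_0_iff)
  define \<omega> where "\<omega> a = L (l a)" for a
  have low: "L r = (\<Sum>x\<in>X. \<omega> x * poly r x)" if "degree r < n" for r
  proof -
    have "r = (\<Sum>a\<in>X. smult (poly r a) (l a))"
    proof (rule poly_eqI_degree)
      show "degree r < card X" using that X by simp
      show "degree (\<Sum>a\<in>X. smult (poly r a) (l a)) < card X"
        using that X deg_l by (intro degree_sum_less) (auto intro: order_le_less_trans[OF degree_smult_le])
      fix x assume "x \<in> X"
      then show "poly r x = poly (\<Sum>a\<in>X. smult (poly r a) (l a)) x"
        using X(1) by (simp add: poly_sum l if_distrib cong: if_cong)
    qed
    then have "L r = L (\<Sum>a\<in>X. smult (poly r a) (l a))" by simp
    then show ?thesis by (simp add: sum smult \<omega>_def mult.commute)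
  qed
  have exact: "L p = (\<Sum>x\<in>X. \<omega> x * poly p x)" if p: "degree p < 2 * n" for p
  proof -
    define u where "u = p div q"
    define r where "r = p mod q"
    have pq: "p = q * u + r" by (simp add: u_def r_def)
    have n: "n > 0" using p by simp
    have r: "degree r < n" using degree_mod_less[OF q0, of p] n q(1) by (auto simp: r_def)
    have u: "degree u < n"
    proof (cases "u = 0")
      case False
      have "degree (q * u) \<le> max (degree p) (degree r)"
        using degree_diff_le_max[of p r] pq by simp
      then show ?thesis using p r False q0 q(1) by (simp add: degree_mult_eq)
    qed (use n in simp)
    have "L p = L r" using q(3)[OF u] by (simp add: pq add)
    also have "\<dots> = (\<Sum>x\<in>X. \<omega> x * poly r x)" by (rule low[OF r])
    also have "\<dots> = (\<Sum>x\<in>X. \<omega> x * poly p x)" by (simp add: pq X_def)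
    finally show ?thesis .
  qed
  have "\<omega> a > 0" if a: "a \<in> X" for a
  proof -
    have "l a \<noteq> 0" using l[OF a, of a] by auto
    then have "0 < L (l a * l a)" by (rule square_pos)
    also have "\<dots> = (\<Sum>x\<in>X. \<omega> x * poly (l a * l a) x)"
      using deg_l[OF a] degree_mult_le[of "l a" "l a"] by (intro exact) simp
    also have "\<dots> = (\<Sum>x\<in>X. if x = a then \<omega> x else 0)"
      by (intro sum.cong) (auto simp: l)
    also have "\<dots> = \<omega> a" using a X(1) by simp
    finally show ?thesis .
  qed
  moreover have "X \<subseteq> {-1<..<1}" by (auto simp: X_def)
  ultimately show ?thesis using that[of X \<omega>] X exact by blast
qed

end

section \<open>Positive quadrature rules for a weight\<close>

definition positive_rule :: "(real \<Rightarrow> real) \<Rightarrow> real set \<Rightarrow> real set \<Rightarrow> (real \<Rightarrow> real) \<Rightarrow> bool" where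
  "positive_rule w S X \<beta> \<longleftrightarrow> finite X \<and> X \<subseteq> {-1<..<1} \<and> (\<forall>x\<in>X. \<beta> x > 0) \<and>
     (\<forall>s\<in>S. (LINT x:{-1..1}|lebesgue. w x / (1 + s * x)) = (\<Sum>x\<in>X. \<beta> x / (1 + s * x)))"

lemma is_gauss_nodes_iff:
  "is_gauss_nodes w m s X \<longleftrightarrow> card X = m \<and> (\<exists>\<beta>. positive_rule w (s ` {1..2 * m}) X \<beta>)"
  unfolding is_gauss_nodes_def positive_rule_def by auto

lemma positive_rule_subset: "positive_rule w S X \<beta> \<Longrightarrow> S' \<subseteq> S \<Longrightarrow> positive_rule w S' X \<beta>"
  by (auto simp: positive_rule_def)

lemma positive_rules_cases:
  assumes S: "finite S" "S \<subseteq> {-1<..<1}" "S \<noteq> {}"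
    and A: "positive_rule w S A \<alpha>" and B: "positive_rule w S B \<beta>"
    and card: "card A + card B \<le> card S + 1" "card A \<le> card B + 1" "card B \<le> card A + 1"
  shows "(A = B \<and> (\<forall>x\<in>A. \<alpha> x = \<beta> x)) \<or>
    (card A + card B = card S + 1 \<and> strictly_interlacing A B)"
  using A B unfolding positive_rule_def by (intro two_rules_cases S card) auto

definition weighted_functional :: "(real \<Rightarrow> real) \<Rightarrow> real set \<Rightarrow> real poly \<Rightarrow> real" where
  "weighted_functional w S p =
     (LINT x:{-1..1}|lebesgue. w x * (poly p x / poly (pole_poly S) x))"

context
  fixes w :: "real \<Rightarrow> real"
  assumes w_int: "set_integrable lebesgue {-1..1} w"
    and w_pos: "AE x\<in>{-1..1} in lebesgue. w x > 0"
begin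

lemma weight_times_continuous_integrable:
  fixes f :: "real \<Rightarrow> real"
  assumes "continuous_on {-1..1} f"
  shows "set_integrable lebesgue {-1..1} (\<lambda>x. w x * f x)"
proof -
  have "set_integrable lebesgue {-1..1} (\<lambda>x. f x * w x)"
  proof (rule absolutely_integrable_bounded_measurable_product_real)
    show "f \<in> borel_measurable (lebesgue_on {-1..1})"
      using assms by (intro continuous_imp_measurable_on_sets_lebesgue) auto
    show "bounded (f ` {-1..1})"
      using assms by (intro compact_imp_bounded compact_continuous_image) auto
  qed (use w_int in auto)
  then show ?thesis by (simp add: mult.commute)
qed

text \<open>The integrand is positive off a finite set, hence almost everywhere, and \<open>[-1, 1]\<close> is not null.\<close>
lemma weighted_integral_pos:
  fixes f :: "real \<Rightarrow> real"
  assumes cont: "continuous_on {-1..1} f" and nonneg: "\<And>x. x \<in> {-1<..<1} \<Longrightarrow> f x \<ge> 0"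
    and fin: "finite {x \<in> {-1..1}. f x = 0}"
  shows "(LINT x:{-1..1}|lebesgue. w x * f x) > 0"
proof -
  define g where "g x = indicator {-1..1} x *\<^sub>R (w x * f x)" for x :: real
  define F where "F = {x \<in> {-1..1}. f x = 0} \<union> {-1, 1}"
  have "finite F" using fin by (simp add: F_def)
  then have "F \<in> null_sets lebesgue"
    using finite_imp_null_set_lborel by (intro null_sets_completionI) auto
  then have F: "AE x in lebesgue. x \<notin> F" by (rule AE_not_in)
  have int: "integrable lebesgue g"
    using weight_times_continuous_integrable[OF cont] by (simp add: set_integrable_def g_def[abs_def])
  have pos: "AE x in lebesgue. x \<in> {-1..1} \<longrightarrow> g x > 0"
    using w_pos F
  proof eventually_elim
    case (elim x)
    show ?case
    proof
      assume x: "x \<in> {-1..1}"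
      then have "f x > 0" using nonneg[of x] elim(2) by (force simp: F_def)
      then show "g x > 0" using elim(1) x by (simp add: g_def)
    qed
  qed
  then have ge: "AE x in lebesgue. 0 \<le> g x"
    by eventually_elim (auto simp: g_def indicator_def)
  have "integral\<^sup>L lebesgue g \<noteq> 0"
  proof
    assume "integral\<^sup>L lebesgue g = 0"
    then have "AE x in lebesgue. g x = 0" using integral_nonneg_eq_0_iff_AE[OF int ge] by simp
    with pos have "AE x in lebesgue. x \<notin> {-1..1::real}" by eventually_elim auto
    then have "{-1..1::real} \<in> null_sets lebesgue" by (subst AE_iff_null_sets) auto
    then have "emeasure lebesgue {-1..1::real} = 0" by auto
    then show False by simp
  qed
  moreover have "integral\<^sup>L lebesgue g \<ge> 0" using ge by (rule integral_nonneg_AE)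
  ultimately show ?thesis by (simp add: set_lebesgue_integral_def g_def[abs_def])
qed

lemma quotient_continuous:
  assumes "S \<subseteq> {-1<..<1}"
  shows "continuous_on {-1..1} (\<lambda>x. poly p x / poly (pole_poly S) x)"
  using pole_poly_pos[OF assms] by (intro continuous_intros) force

lemma weighted_functional_positive:
  assumes S: "S \<subseteq> {-1<..<1}"
  shows "positive_functional (weighted_functional w S)"
proof
  note int = weight_times_continuous_integrable[OF quotient_continuous[OF S]]
  fix p q :: "real poly" and c :: real
  show "weighted_functional w S (p + q) = weighted_functional w S p + weighted_functional w S q"
    using set_integral_add(2)[OF int int]
    by (simp add: weighted_functional_def add_divide_distrib distrib_left)
  show "weighted_functional w S (smult c p) = c * weighted_functional w S p"
    unfolding weighted_functional_def set_integral_mult_right[symmetric] by (simp add: mult_ac)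
  show "weighted_functional w S p > 0" if "p \<noteq> 0" "\<And>x. x \<in> {-1<..<1} \<Longrightarrow> poly p x \<ge> 0"
    unfolding weighted_functional_def
  proof (rule weighted_integral_pos[OF quotient_continuous[OF S]])
    fix x :: real assume x: "x \<in> {-1<..<1}"
    then show "poly p x / poly (pole_poly S) x \<ge> 0"
      using that(2)[OF x] pole_poly_pos[OF S, of x] by simp
  next
    have "{x \<in> {-1..1}. poly p x / poly (pole_poly S) x = 0} \<subseteq> {x. poly p x = 0}"
      using pole_poly_pos[OF S] by fastforce
    then show "finite {x \<in> {-1..1}. poly p x / poly (pole_poly S) x = 0}"
      using poly_roots_finite[OF that(1)] finite_subset by blast
  qed
qed

lemma weighted_functional_eq_sum:
  assumes S: "finite S" "S \<subseteq> {-1<..<1}" and rule: "positive_rule w S X \<beta>"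
    and p: "degree p < card S"
  shows "weighted_functional w S p = (\<Sum>x\<in>X. \<beta> x * (poly p x / poly (pole_poly S) x))"
proof -
  obtain d where d: "\<And>x. (\<forall>s\<in>S. 1 + s * x \<noteq> 0) \<Longrightarrow>
    poly p x / poly (pole_poly S) x = (\<Sum>s\<in>S. d s / (1 + s * x))"
    using partial_fractions S(1) p by blast
  have pf: "poly p x / poly (pole_poly S) x = (\<Sum>s\<in>S. d s / (1 + s * x))" if x: "x \<in> {-1..1}" for x
    using one_plus_mult_pos[OF _ x] S(2) by (intro d) force
  have X: "X \<subseteq> {-1..1}" using rule by (force simp: positive_rule_def)
  have int: "set_integrable lebesgue {-1..1} (\<lambda>x. d s * (w x / (1 + s * x)))" if "s \<in> S" for s
  proof -
    have "1 + s * x \<noteq> 0" if "x \<in> {-1..1}" for x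
      using one_plus_mult_pos[of s x] S(2) that \<open>s \<in> S\<close> by auto
    then have "continuous_on {-1..1} (\<lambda>x. d s / (1 + s * x))"
      by (intro continuous_intros) auto
    then have "set_integrable lebesgue {-1..1} (\<lambda>x. w x * (d s / (1 + s * x)))"
      by (rule weight_times_continuous_integrable)
    then show ?thesis by (simp add: mult.commute)
  qed
  have "weighted_functional w S p
      = (LINT x:{-1..1}|lebesgue. (\<Sum>s\<in>S. d s * (w x / (1 + s * x))))"
    unfolding weighted_functional_def
    by (rule set_lebesgue_integral_cong) (auto simp: pf sum_distrib_left mult_ac)
  also have "\<dots> = (\<Sum>s\<in>S. LINT x:{-1..1}|lebesgue. d s * (w x / (1 + s * x)))"
    using int unfolding set_lebesgue_integral_def set_integrable_def scaleR_sum_right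
    by (rule Bochner_Integration.integral_sum)
  also have "\<dots> = (\<Sum>s\<in>S. d s * (\<Sum>x\<in>X. \<beta> x / (1 + s * x)))"
    using rule by (intro sum.cong refl) (simp only: positive_rule_def set_integral_mult_right)
  also have "\<dots> = (\<Sum>x\<in>X. \<beta> x * (\<Sum>s\<in>S. d s / (1 + s * x)))"
    unfolding sum_distrib_left by (subst sum.swap) (simp add: mult_ac)
  also have "\<dots> = (\<Sum>x\<in>X. \<beta> x * (poly p x / poly (pole_poly S) x))"
  proof (rule sum.cong[OF refl])
    fix x assume "x \<in> X"
    then have "x \<in> {-1..1}" using X by blast
    then show "\<beta> x * (\<Sum>s\<in>S. d s / (1 + s * x)) = \<beta> x * (poly p x / poly (pole_poly S) x)"
      by (simp only: pf)
  qed
  finally show ?thesis .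
qed

text \<open>Gauss quadrature for the weight \<open>w / pole_poly S\<close>, tested with the polynomials
  \<open>pole_poly (S - {s})\<close>; the denominator is moved into the weights \<open>\<beta>\<close>.\<close>
lemma positive_rule_exists:
  assumes S: "finite S" "S \<subseteq> {-1<..<1}" "card S = 2 * m"
  shows "\<exists>X \<beta>. card X = m \<and> positive_rule w S X \<beta>"
proof -
  interpret positive_functional "weighted_functional w S"
    by (rule weighted_functional_positive[OF S(2)])
  obtain X \<omega> where X: "finite X" "card X = m" "X \<subseteq> {-1<..<1}" "\<And>x. x \<in> X \<Longrightarrow> \<omega> x > 0"
    and exact: "\<And>p. degree p < 2 * m \<Longrightarrow> weighted_functional w S p = (\<Sum>x\<in>X. \<omega> x * poly p x)"
    using gauss_quadrature by blast
  define \<beta> where "\<beta> x = \<omega> x * poly (pole_poly S) x" for x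
  have X': "X \<subseteq> {-1..1}" using X(3) by force
  have "(LINT x:{-1..1}|lebesgue. w x / (1 + s * x)) = (\<Sum>x\<in>X. \<beta> x / (1 + s * x))"
    if s: "s \<in> S" for s
  proof -
    let ?p = "pole_poly (S - {s})"
    have split: "poly (pole_poly S) x = (1 + s * x) * poly ?p x" for x
      using S(1) s by (simp add: poly_pole_poly prod.remove)
    have pos: "1 + s * x > 0" "poly ?p x > 0" if "x \<in> {-1..1}" for x
      using one_plus_mult_pos[OF _ that] pole_poly_pos[OF _ that, of "S - {s}"] S(2) s by blast+
    have "card (S - {s}) < card S" using S(1) s by (intro psubset_card_mono) auto
    then have deg: "degree ?p < 2 * m" using degree_pole_poly_le[of "S - {s}"] S(3) by simp
    have "w x / (1 + s * x) = w x * (poly ?p x / poly (pole_poly S) x)" if "x \<in> {-1..1}" for x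
      using pos[OF that] by (simp add: split)
    then have "(LINT x:{-1..1}|lebesgue. w x / (1 + s * x)) = weighted_functional w S ?p"
      unfolding weighted_functional_def by (intro set_lebesgue_integral_cong) auto
    also have "\<dots> = (\<Sum>x\<in>X. \<omega> x * poly ?p x)" by (rule exact[OF deg])
    also have "\<dots> = (\<Sum>x\<in>X. \<beta> x / (1 + s * x))"
    proof (rule sum.cong[OF refl])
      fix x assume "x \<in> X"
      then have "1 + s * x > 0" using pos X' by blast
      then show "\<omega> x * poly ?p x = \<beta> x / (1 + s * x)" by (simp add: \<beta>_def split)
    qed
    finally show ?thesis .
  qed
  moreover have "\<beta> x > 0" if "x \<in> X" for x
    using X(4)[OF that] pole_poly_pos[OF S(2), of x] X' that by (auto simp: \<beta>_def)
  ultimately have "positive_rule w S X \<beta>" using X by (simp add: positive_rule_def)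
  then show ?thesis using X(2) by blast
qed

lemma gauss_nodes_rule:
  assumes "m \<ge> 1" "inj_on s {1..2 * m}" "s ` {1..2 * m} \<subseteq> {-1<..<1}"
  obtains \<beta> where "card (gauss_nodes w m s) = m"
    "positive_rule w (s ` {1..2 * m}) (gauss_nodes w m s) \<beta>"
proof -
  let ?S = "s ` {1..2 * m}"
  have card: "card ?S = 2 * m" using assms(2) by (simp add: card_image)
  then have ne: "?S \<noteq> {}" using assms(1) by auto
  have "\<exists>!X. is_gauss_nodes w m s X"
  proof (rule ex_ex1I)
    show "\<exists>X. is_gauss_nodes w m s X"
      using positive_rule_exists[of ?S m] card assms(3) by (auto simp: is_gauss_nodes_iff)
    show "X = Y" if "is_gauss_nodes w m s X" "is_gauss_nodes w m s Y" for X Y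
      using that positive_rules_cases[of ?S w X _ Y] card ne assms(3)
      by (auto simp: is_gauss_nodes_iff)
  qed
  then have "is_gauss_nodes w m s (gauss_nodes w m s)"
    unfolding gauss_nodes_def by (rule theI')
  then show ?thesis using that by (auto simp: is_gauss_nodes_iff)
qed

text \<open>The square of the node polynomial has degree \<open>2 * card X\<close>. Were it a test function, its weighted
  integral would equal a sum that is zero, although the integral is positive.\<close>
lemma positive_rule_not_overexact:
  assumes S: "finite S" "S \<subseteq> {-1<..<1}" and rule: "positive_rule w S X \<beta>"
  shows "card S \<le> 2 * card X"
proof (rule ccontr)
  assume over: "\<not> card S \<le> 2 * card X"
  interpret positive_functional "weighted_functional w S"
    by (rule weighted_functional_positive[OF S(2)])
  let ?p = "root_poly X * root_poly X"
  have "finite X" using rule by (simp add: positive_rule_def)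
  have "degree ?p < card S"
    using over by (simp add: degree_mult_eq root_poly_nonzero degree_root_poly)
  then have "weighted_functional w S ?p = (\<Sum>x\<in>X. \<beta> x * (poly ?p x / poly (pole_poly S) x))"
    by (rule weighted_functional_eq_sum[OF S rule])
  also have "\<dots> = 0"
    using \<open>finite X\<close> by (intro sum.neutral) (simp add: poly_root_poly_eq_0_iff)
  finally show False using square_pos[OF root_poly_nonzero, of X] by simp
qed

end

section \<open>Interlacing of the nodes\<close>

theorem mainTheorem4:
  fixes w :: "real \<Rightarrow> real" and t :: "nat \<Rightarrow> real" and n :: nat
  assumes "set_integrable lebesgue {-1..1} w"
    and "AE x\<in>{-1..1} in lebesgue. w x > 0"
    and "n \<ge> 1"
    and "\<forall>k\<ge>1. t k \<in> {-1<..<1}"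
    and "inj_on t {1..}"
  shows "strictly_interlacing (gauss_nodes w n t) (gauss_nodes w (n + 1) t) \<and>
         strictly_interlacing (gauss_nodes w n t) (gauss_nodes w n (t(2 * n := t (2 * n + 1))))"
proof
  have t: "t ` K \<subseteq> {-1<..<1}" "inj_on t K" "card (t ` K) = card K" if "K \<subseteq> {1..}" for K
  proof -
    show "t ` K \<subseteq> {-1<..<1}" using assms(4) that by auto
    show inj: "inj_on t K" using assms(5) that by (rule inj_on_subset)
    show "card (t ` K) = card K" using inj by (rule card_image)
  qed
  let ?A = "gauss_nodes w n t"
  obtain \<alpha> where A: "card ?A = n" "positive_rule w (t ` {1..2 * n}) ?A \<alpha>"
    using gauss_nodes_rule[OF assms(1-3), of t] t[of "{1..2 * n}"] by auto
  show "strictly_interlacing ?A (gauss_nodes w (n + 1) t)"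
  proof -
    let ?B = "gauss_nodes w (n + 1) t"
    obtain \<beta> where B: "card ?B = n + 1" "positive_rule w (t ` {1..2 * (n + 1)}) ?B \<beta>"
      using gauss_nodes_rule[OF assms(1,2), of "n + 1" t] t[of "{1..2 * (n + 1)}"] by auto
    have "positive_rule w (t ` {1..2 * n}) ?B \<beta>"
      using B(2) by (rule positive_rule_subset) auto
    then show ?thesis
      using positive_rules_cases[OF _ _ _ A(2)] t[of "{1..2 * n}"] A(1) B(1) assms(3) by fastforce
  qed
  show "strictly_interlacing ?A (gauss_nodes w n (t(2 * n := t (2 * n + 1))))"
  proof -
    define s where "s = t(2 * n := t (2 * n + 1))"
    let ?B = "gauss_nodes w n s"
    let ?K = "{1..2 * n - 1}"
    have s: "s ` {1..2 * n} = t ` insert (2 * n + 1) ?K"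
    proof -
      have "{1..2 * n} = insert (2 * n) ?K" using assms(3) by auto
      moreover have "s ` ?K = t ` ?K" using assms(3) by (intro image_cong) (auto simp: s_def)
      moreover have "s (2 * n) = t (2 * n + 1)" by (simp add: s_def)
      ultimately show ?thesis by (simp only: image_insert)
    qed
    have "card (insert (2 * n + 1) ?K) = 2 * n" using assms(3) by simp
    then have "card (s ` {1..2 * n}) = card {1..2 * n}"
      unfolding s using t(3)[of "insert (2 * n + 1) ?K"] by simp
    then have "inj_on s {1..2 * n}" by (intro eq_card_imp_inj_on) auto
    moreover have "s ` {1..2 * n} \<subseteq> {-1<..<1}" unfolding s by (rule t) auto
    ultimately obtain \<beta> where B: "card ?B = n" "positive_rule w (t ` insert (2 * n + 1) ?K) ?B \<beta>"
      using gauss_nodes_rule[OF assms(1-3), of s] unfolding s by blast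
    have "positive_rule w (t ` ?K) ?A \<alpha>" "positive_rule w (t ` ?K) ?B \<beta>"
      by (rule positive_rule_subset[OF A(2)] positive_rule_subset[OF B(2)]; auto)+
    moreover have "card (t ` ?K) = 2 * n - 1" "t ` ?K \<subseteq> {-1<..<1}" "t ` ?K \<noteq> {}"
      using t[of ?K] assms(3) by auto
    ultimately consider "?A = ?B" "\<forall>x\<in>?A. \<alpha> x = \<beta> x" | "strictly_interlacing ?A ?B"
      using positive_rules_cases[of "t ` ?K" w ?A \<alpha> ?B \<beta>] A(1) B(1) assms(3) by auto
    then have "strictly_interlacing ?A ?B"
    proof cases
      case 1
      \<comment> \<open>A common rule would be exact for all of \<open>t 1, \<dots>, t (2 * n + 1)\<close>, one function too many.\<close>
      have "(\<Sum>x\<in>?A. \<alpha> x / (1 + \<sigma> * x)) = (\<Sum>x\<in>?B. \<beta> x / (1 + \<sigma> * x))" for \<sigma>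
        using 1 by (intro sum.cong) auto
      moreover have "{1..2 * n + 1} = {1..2 * n} \<union> insert (2 * n + 1) ?K" using assms(3) by auto
      ultimately have "positive_rule w (t ` {1..2 * n + 1}) ?A \<alpha>"
        using A(2) B(2) unfolding positive_rule_def by (simp add: image_Un ball_Un)
      then have "card (t ` {1..2 * n + 1}) \<le> 2 * card ?A"
        by (intro positive_rule_not_overexact[OF assms(1,2)] t(1)) auto
      then have "card (t ` {1..2 * n + 1}) \<le> 2 * n" by (simp add: A(1))
      then show ?thesis using t(3)[of "{1..2 * n + 1}"] by simp
    qed
    then show ?thesis by (simp add: s_def)
  qed
qed

end
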